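(* Let $G=(V,E)$ be a connected, undirected, unweighted multigraph with $m\ge 1$ edges (counted with multiplicity) which is a $\Phi$-expander. Let $\mathbf{B}\in\mathbb{R}^{V\times E}$ be its edge-vertex incidence matrix, $\mathbf{L}=\mathbf{B}\mathbf{B}^\top$ its Laplacian, and $\mathbf{A}_{\mathcal{E}}=\mathbf{B}^\top\mathbf{L}^+$ the electrical routing. Then \[ \rho_\infty(\mathbf{A}_{\mathcal{E}}),\ \rho_1(\mathbf{A}_{\mathcal{E}}) \le 3\cdot\frac{\log(2m)}{\Phi}. \]
   Context: Each edge is given an arbitrary orientation; $\mathbf{B}(u,e)=-1$ if $e=(u,v)$, $\mathbf{B}(u,e)=1$ if $e=(v,u)$, and $0$ otherwise. $\mathbf{L}^+$ is the Moore–Penrose pseudo-inverse. $\log$ denotes the natural logarithm. $G$ is a $\Phi$-expander if $|\partial S|\ge \Phi\cdot\mathrm{vol}(S)$ for every $S\subseteq V$ with $\mathrm{vol}(S)\le \mathrm{vol}(V)/2$, where $|\partial S|$ is the number of edges (with multiplicity) with exactly one endpoint in $S$ and $\mathrm{vol}(S)$ is the sum of degrees of vertices in $S$. A demand is a vector $\boldsymbol{\chi}\in\mathbb{R}^V$ with $\mathbf{1}^\top\boldsymbol{\chi}=0$; a flow $\mathbf{f}\in\mathbb{R}^E$ routes $\boldsymbol{\chi}$ if $\mathbf{B}\mathbf{f}=\boldsymbol{\chi}$. An oblivious routing is a linear map $\mathbf{A}\in\mathbb{R}^{E\times V}$ with $\mathbf{B}\mathbf{A}\boldsymbol{\chi}=\boldsymbol{\chi}$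 for all demands $\boldsymbol{\chi}$. For $p\in[1,\infty]$, the $\ell_p$-congestion of a multiset of flows $\{\mathbf{f}_1,\dots,\mathbf{f}_k\}$ is $\|\sum_{i}|\mathbf{f}_i|\|_p$ (absolute value entrywise); for a multiset of demands $D=\{\boldsymbol{\chi}_1,\dots,\boldsymbol{\chi}_k\}$, $\mathrm{opt}_p(D)$ is the minimum $\ell_p$-congestion over all multisets of flows $\{\mathbf{f}_i\}$ with $\mathbf{B}\mathbf{f}_i=\boldsymbol{\chi}_i$ for all $i$. The competitive ratio is $\rho_p(\mathbf{A})=\sup_D \frac{\|\sum_i|\mathbf{A}\boldsymbol{\chi}_i|\|_p}{\mathrm{opt}_p(D)}$, the supremum over multisets $D$ of demands with $\mathrm{opt}_p(D)>0$. *)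

theory Defs
  imports "HOL-Analysis.Analysis" "HOL-Library.Multiset"
begin

text \<open>
  An undirected multigraph with vertex set \<open>UNIV :: 'v set\<close> and edge set \<open>UNIV :: 'e set\<close> is given
  together with an arbitrary orientation: \<open>G e = (u, v)\<close> says that the edge \<open>e\<close> joins \<open>u\<close> and \<open>v\<close>
  and is oriented from \<open>u\<close> to \<open>v\<close>. Only the incidence matrix depends on the orientation.
  Since types are nonempty, there is at least one edge.
\<close>

type_synonym ('v, 'e) multigraph = "'e \<Rightarrow> 'v \<times> 'v"

definition mg_adjacent :: "('v, 'e) multigraph \<Rightarrow> 'v \<Rightarrow> 'v \<Rightarrow> bool" where
  "mg_adjacent G u v \<longleftrightarrow> (\<exists>e. G e = (u, v) \<or> G e = (v, u))"

definition mg_connected :: "('v, 'e) multigraph \<Rightarrow> bool" where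
  "mg_connected G \<longleftrightarrow> (\<forall>u v. (mg_adjacent G)\<^sup>*\<^sup>* u v)"

text \<open>A self-loop contributes 2 to the degree of its vertex.\<close>

definition mg_degree :: "('v, 'e::finite) multigraph \<Rightarrow> 'v \<Rightarrow> nat" where
  "mg_degree G v = card {e. fst (G e) = v} + card {e. snd (G e) = v}"

definition mg_vol :: "('v, 'e::finite) multigraph \<Rightarrow> 'v set \<Rightarrow> nat" where
  "mg_vol G S = (\<Sum>v\<in>S. mg_degree G v)"

definition mg_boundary :: "('v, 'e) multigraph \<Rightarrow> 'v set \<Rightarrow> 'e set" where
  "mg_boundary G S = {e. (fst (G e) \<in> S) \<noteq> (snd (G e) \<in> S)}"

definition mg_expander :: "real \<Rightarrow> ('v::finite, 'e::finite) multigraph \<Rightarrow> bool" where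
  "mg_expander \<Phi> G \<longleftrightarrow>
     (\<forall>S. real (mg_vol G S) \<le> real (mg_vol G UNIV) / 2 \<longrightarrow>
          real (card (mg_boundary G S)) \<ge> \<Phi> * real (mg_vol G S))"

text \<open>Entry \<open>-1\<close> at the tail and \<open>1\<close> at the head; the column of a self-loop is zero.\<close>

definition incidence :: "('v::finite, 'e::finite) multigraph \<Rightarrow> real^'e^'v" where
  "incidence G =
     (\<chi> u e. (if snd (G e) = u then 1 else 0) - (if fst (G e) = u then 1 else 0))"

definition laplacian :: "('v::finite, 'e::finite) multigraph \<Rightarrow> real^'v^'v" where
  "laplacian G = incidence G ** transpose (incidence G)"

text \<open>The Moore--Penrose pseudo-inverse, characterised by the four Penrose equations.\<close>

definition is_pseudo_inverse :: "real^'n^'m \<Rightarrow> real^'m^'n \<Rightarrow> bool" where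
  "is_pseudo_inverse M X \<longleftrightarrow>
     M ** X ** M = M \<and> X ** M ** X = X \<and>
     transpose (M ** X) = M ** X \<and> transpose (X ** M) = X ** M"

definition pseudo_inverse :: "real^'n^'m \<Rightarrow> real^'m^'n" where
  "pseudo_inverse M = (THE X. is_pseudo_inverse M X)"

definition electrical_routing :: "('v::finite, 'e::finite) multigraph \<Rightarrow> real^'v^'e" where
  "electrical_routing G = transpose (incidence G) ** pseudo_inverse (laplacian G)"

definition is_demand :: "real^'v \<Rightarrow> bool" where
  "is_demand d \<longleftrightarrow> (\<Sum>v\<in>UNIV. d $ v) = 0"

definition routes :: "('v::finite, 'e::finite) multigraph \<Rightarrow> real^'e \<Rightarrow> real^'v \<Rightarrow> bool" where
  "routes G f d \<longleftrightarrow> incidence G *v f = d"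

text \<open>The \<open>\<ell>\<^sub>p\<close>-norm, meaningful for \<open>1 \<le> p \<le> \<infinity>\<close>.\<close>

definition lp_norm :: "ereal \<Rightarrow> real^'e \<Rightarrow> real" where
  "lp_norm p x =
     (if p = \<infinity> then Max (range (\<lambda>e. \<bar>x $ e\<bar>))
      else (\<Sum>e\<in>UNIV. \<bar>x $ e\<bar> powr real_of_ereal p) powr (1 / real_of_ereal p))"

text \<open>On \<open>real^'e\<close>, the library's absolute value is taken entrywise.\<close>

definition congestion :: "ereal \<Rightarrow> (real^'e::finite) multiset \<Rightarrow> real" where
  "congestion p F = lp_norm p (\<Sum>f\<in>#F. \<bar>f\<bar>)"

text \<open>
  The relator \<open>rel_mset\<close> says that the flows in \<open>F\<close> and the demands in \<open>D\<close> can be enumerated as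
  \<open>f\<^sub>1, \<dots>, f\<^sub>k\<close> and \<open>d\<^sub>1, \<dots>, d\<^sub>k\<close> such that every \<open>f\<^sub>i\<close> routes \<open>d\<^sub>i\<close>.
\<close>

definition opt_congestion ::
    "('v::finite, 'e::finite) multigraph \<Rightarrow> ereal \<Rightarrow> (real^'v) multiset \<Rightarrow> real" where
  "opt_congestion G p D = Inf {congestion p F |F. rel_mset (routes G) F D}"

definition competitive_ratio ::
    "('v::finite, 'e::finite) multigraph \<Rightarrow> ereal \<Rightarrow> real^'v^'e \<Rightarrow> ereal" where
  "competitive_ratio G p A =
     (SUP D \<in> {D. (\<forall>d\<in>#D. is_demand d) \<and> opt_congestion G p D > 0}.
        ereal (congestion p (image_mset (\<lambda>d. A *v d) D) / opt_congestion G p D))"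

end

theory Submission
  imports Defs
begin

text \<open>
  The matrix \<open>R = A B = B\<^sup>T L\<^sup>+ B\<close> is symmetric, so both competitive ratios are at most its largest
  absolute column sum. The column of an edge \<open>e\<close> consists of the potential differences of the
  potential \<open>x\<close> of a unit electrical flow between the ends of \<open>e\<close>.

  Let \<open>c(t)\<close> be the number of edges crossing the threshold cut \<open>S\<^sub>t = {x > t}\<close>; the column sum is the
  integral of \<open>c\<close>. Spread one unit of mass uniformly along each edge and let \<open>W(t)\<close> be the mass above
  \<open>t\<close>. At most one unit of flow crosses \<open>S\<^sub>t\<close>, so the lengths of the crossing edges sum to at most 1,
  and by Cauchy--Schwarz \<open>c\<^sup>2 \<le> - W'\<close>. Above the median potential, expansion gives
  \<open>c \<ge> \<Phi> vol(S\<^sub>t) \<ge> \<Phi> max(1, W)\<close> whenever \<open>c > 0\<close>. Hence \<open>\<Phi> c \<le> - W' / max(1, W)\<close>, which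
  integrates to at most \<open>1 + ln m\<close> above the median, and symmetrically below it. Finally
  \<open>2 + 2 ln m \<le> 3 ln (2 m)\<close>, because \<open>ln 2 \<ge> 2/3\<close>.
\<close>

section \<open>Volumes and cuts\<close>

lemma sum_card_fibres:
  fixes f :: "'e::finite \<Rightarrow> 'v::finite"
  shows "(\<Sum>v\<in>S. card {e. f e = v}) = card {e. f e \<in> S}"
proof -
  have "card {e. f e \<in> S} = card (\<Union>v\<in>S. {e. f e = v})"
    by (rule arg_cong[where f = card]) auto
  also have "\<dots> = (\<Sum>v\<in>S. card {e. f e = v})"
    by (rule card_UN_disjoint) auto
  finally show ?thesis by simp
qed

lemma mg_vol_eq:
  fixes G :: "('v::finite, 'e::finite) multigraph"
  shows "mg_vol G S = card {e. fst (G e) \<in> S} + card {e. snd (G e) \<in> S}"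
  by (simp add: mg_vol_def mg_degree_def sum.distrib
        sum_card_fibres[of "\<lambda>e. fst (G e)"] sum_card_fibres[of "\<lambda>e. snd (G e)"])

lemma mg_vol_UNIV:
  fixes G :: "('v::finite, 'e::finite) multigraph"
  shows "mg_vol G UNIV = 2 * CARD('e)"
  by (simp add: mg_vol_eq)

lemma mg_vol_mono:
  fixes G :: "('v::finite, 'e::finite) multigraph"
  shows "S \<subseteq> T \<Longrightarrow> mg_vol G S \<le> mg_vol G T"
  unfolding mg_vol_def by (rule sum_mono2) auto

lemma mg_vol_Compl:
  fixes G :: "('v::finite, 'e::finite) multigraph"
  shows "mg_vol G S + mg_vol G (- S) = 2 * CARD('e)"
  using sum.union_disjoint[of S "- S" "mg_degree G"] mg_vol_UNIV[of G]
  by (simp add: mg_vol_def)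

lemma card_incident_le_mg_vol:
  fixes G :: "('v::finite, 'e::finite) multigraph"
  shows "card {e. fst (G e) \<in> S \<or> snd (G e) \<in> S} \<le> mg_vol G S"
proof -
  have "{e. fst (G e) \<in> S \<or> snd (G e) \<in> S} = {e. fst (G e) \<in> S} \<union> {e. snd (G e) \<in> S}"
    by auto
  then show ?thesis
    by (simp add: mg_vol_eq card_Un_le)
qed

lemma card_mg_boundary_le_mg_vol:
  fixes G :: "('v::finite, 'e::finite) multigraph"
  shows "card (mg_boundary G S) \<le> mg_vol G S"
proof -
  have "card (mg_boundary G S) \<le> card {e. fst (G e) \<in> S \<or> snd (G e) \<in> S}"
    by (rule card_mono) (auto simp: mg_boundary_def)
  with card_incident_le_mg_vol[of G S] show ?thesis by linarith
qed

text \<open>Take the least potential with at most half of the total volume strictly above it. The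
  next smaller potential has more than half strictly above it, and the complement of that upper set
  is everything below the chosen potential.\<close>

lemma median_threshold:
  fixes G :: "('v::finite, 'e::finite) multigraph" and x :: "'v \<Rightarrow> real"
  obtains t where "mg_vol G {v. t < x v} \<le> CARD('e)" "mg_vol G {v. x v < t} \<le> CARD('e)"
proof -
  define Q where "Q = {t \<in> range x. mg_vol G {v. t < x v} \<le> CARD('e)}"
  have fin: "finite Q" by (simp add: Q_def)
  have "{v. Max (range x) < x v} = {}"
    by (auto simp: not_less)
  then have "mg_vol G {v. Max (range x) < x v} = 0"
    by (simp only: mg_vol_def sum.empty)
  then have "Max (range x) \<in> Q"
    unfolding Q_def by (simp del: Max_less_iff)
  then have ne: "Q \<noteq> {}" by auto
  define t where "t = Min Q"
  have t: "t \<in> Q" using Min_in[OF fin ne] by (simp add: t_def)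
  have "mg_vol G {v. x v < t} \<le> CARD('e)"
  proof (cases "{v. x v < t} = {}")
    case True
    then show ?thesis by (simp add: mg_vol_def)
  next
    case False
    define s where "s = Max (x ` {v. x v < t})"
    have "s \<in> x ` {v. x v < t}"
      unfolding s_def using False by (intro Max_in) auto
    then have s: "s \<in> range x" "s < t" by auto
    have "s \<notin> Q" using Min_le[OF fin, of s] s(2) by (auto simp: t_def)
    then have vs: "mg_vol G {v. s < x v} > CARD('e)" using s(1) by (auto simp: Q_def)
    have "x v \<le> s" if "x v < t" for v
      unfolding s_def using that by (intro Max_ge) auto
    then have "- {v. s < x v} = {v. x v < t}" using s(2) by (force simp: not_less)
    then show ?thesis
      using mg_vol_Compl[of G "{v. s < x v}"] vs by simp
  qed
  with t that show ?thesis by (auto simp: Q_def)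
qed

section \<open>Threshold cuts of a potential\<close>

text \<open>The integral of the cut size over all thresholds beyond \<open>t\<close>, in closed
  form: clamping both end potentials at \<open>t\<close> keeps the part of an edge that lies above
  \<open>t\<close>.\<close>

definition length_above ::
    "('v, 'e::finite) multigraph \<Rightarrow> ('v \<Rightarrow> real) \<Rightarrow> real \<Rightarrow> real" where
  "length_above G x t = (\<Sum>e\<in>UNIV. \<bar>max (x (fst (G e))) t - max (x (snd (G e))) t\<bar>)"

text \<open>
  Every edge with distinct end potentials carries one unit of mass, spread uniformly over the
  interval between them. Edges of length 0 get no mass, because \<open>0 / 0 = 0\<close>.
\<close>

definition mass_above ::
    "('v, 'e::finite) multigraph \<Rightarrow> ('v \<Rightarrow> real) \<Rightarrow> real \<Rightarrow> real" where
  "mass_above G x t =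
     (\<Sum>e\<in>UNIV. \<bar>max (x (fst (G e))) t - max (x (snd (G e))) t\<bar> / \<bar>x (fst (G e)) - x (snd (G e))\<bar>)"

lemma continuous_on_length_above [continuous_intros]: "continuous_on S (length_above G x)"
  unfolding length_above_def by (intro continuous_intros)

lemma continuous_on_mass_above [continuous_intros]: "continuous_on S (mass_above G x)"
  unfolding mass_above_def divide_inverse by (intro continuous_intros)

lemma abs_diff_max_antimono:
  fixes a b s t :: real
  shows "s \<le> t \<Longrightarrow> \<bar>max a t - max b t\<bar> \<le> \<bar>max a s - max b s\<bar>"
  by (auto simp: max_def abs_if)

lemma mass_above_antimono: "s \<le> t \<Longrightarrow> mass_above G x t \<le> mass_above G x s"
  unfolding mass_above_def by (intro sum_mono divide_right_mono abs_diff_max_antimono) auto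

text \<open>Each edge holds at most one unit of mass, and some of it lies above \<open>t\<close>
  only if an end does.\<close>

lemma mass_above_le_mg_vol:
  fixes G :: "('v::finite, 'e::finite) multigraph"
  shows "mass_above G x t \<le> real (mg_vol G {v. t < x v})"
proof -
  let ?I = "{e. fst (G e) \<in> {v. t < x v} \<or> snd (G e) \<in> {v. t < x v}}"
  have "mass_above G x t \<le> (\<Sum>e\<in>UNIV. if e \<in> ?I then 1 else 0)"
    unfolding mass_above_def
  proof (rule sum_mono)
    fix e
    let ?a = "x (fst (G e))" and ?b = "x (snd (G e))"
    have "\<bar>max ?a t - max ?b t\<bar> \<le> \<bar>?a - ?b\<bar>" by (auto simp: max_def abs_if)
    then have "\<bar>max ?a t - max ?b t\<bar> / \<bar>?a - ?b\<bar> \<le> 1"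
      by (simp add: divide_le_eq_1)
    then show "\<bar>max ?a t - max ?b t\<bar> / \<bar>?a - ?b\<bar> \<le> (if e \<in> ?I then 1 else 0)"
      by (auto simp: not_less max_absorb2)
  qed
  also have "\<dots> = real (card ?I)" by (simp add: sum.If_cases)
  also have "\<dots> \<le> real (mg_vol G {v. t < x v})"
    using card_incident_le_mg_vol by (simp only: of_nat_le_iff)
  finally show ?thesis .
qed

lemma above_all_potentials_eq_0:
  fixes G :: "('v::finite, 'e::finite) multigraph"
  assumes "\<And>v. x v \<le> t"
  shows "length_above G x t = 0" "mass_above G x t = 0"
  using assms by (simp_all add: length_above_def mass_above_def max_absorb2)

section \<open>Derivatives with respect to the threshold\<close>

lemma DERIV_abs_diff_max:
  fixes a b t :: real
  assumes "t \<noteq> a" "t \<noteq> b"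
  shows "((\<lambda>t. \<bar>max a t - max b t\<bar>) has_real_derivative
           (if (t < a) \<noteq> (t < b) then -1 else 0)) (at t)"
proof -
  define d where "d = min \<bar>t - a\<bar> \<bar>t - b\<bar>"
  have d: "d > 0" using assms by (simp add: d_def)
  \<comment> \<open>The comparisons are frozen at \<open>t\<close>, which makes \<open>g\<close>
    affine in \<open>s\<close>. Within distance \<open>d\<close> of \<open>t\<close> no comparison
    changes, so \<open>g\<close> agrees there with the clamped length.\<close>
  define g where "g = (\<lambda>s. if t < a \<and> t < b then \<bar>a - b\<bar> else if t < a then a - s
                          else if t < b then b - s else 0)"
  have "(g has_real_derivative (if (t < a) \<noteq> (t < b) then -1 else 0)) (at t)"
    unfolding g_def by (auto intro!: derivative_eq_intros)
  moreover have "g s = \<bar>max a s - max b s\<bar>" if "dist s t < d" for s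
    using that assms unfolding g_def d_def dist_real_def by (auto simp: max_def abs_if split: if_splits)
  ultimately show ?thesis
    using d by (auto intro: has_field_derivative_transform_within[where d = d])
qed

text \<open>As \<open>t\<close> rises, each crossing edge loses length at unit rate and the other
  edges lose none. At a vertex potential there may be a kink.\<close>

lemma DERIV_length_above:
  fixes G :: "('v::finite, 'e::finite) multigraph"
  assumes "t \<notin> range x"
  shows "(length_above G x has_real_derivative - real (card (mg_boundary G {v. t < x v}))) (at t)"
proof -
  have "(length_above G x has_real_derivative
      (\<Sum>e\<in>UNIV. if (t < x (fst (G e))) \<noteq> (t < x (snd (G e))) then -1 else 0)) (at t)"
    unfolding length_above_def[abs_def] using assms
    by (intro DERIV_sum DERIV_abs_diff_max) auto
  then show ?thesis
    by (simp add: sum.If_cases mg_boundary_def)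
qed

lemma DERIV_mass_above:
  fixes G :: "('v::finite, 'e::finite) multigraph"
  assumes "t \<notin> range x"
  shows "(mass_above G x has_real_derivative
            - (\<Sum>e\<in>mg_boundary G {v. t < x v}. 1 / \<bar>x (fst (G e)) - x (snd (G e))\<bar>)) (at t)"
proof -
  have "(mass_above G x has_real_derivative
      (\<Sum>e\<in>UNIV. (if (t < x (fst (G e))) \<noteq> (t < x (snd (G e))) then -1 else 0)
                  / \<bar>x (fst (G e)) - x (snd (G e))\<bar>)) (at t)"
    unfolding mass_above_def[abs_def] using assms
    by (intro DERIV_sum DERIV_cdivide DERIV_abs_diff_max) auto
  also have "(\<Sum>e\<in>UNIV. (if (t < x (fst (G e))) \<noteq> (t < x (snd (G e))) then -1 else 0)
                  / \<bar>x (fst (G e)) - x (snd (G e))\<bar>)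
     = (\<Sum>e\<in>UNIV. if e \<in> mg_boundary G {v. t < x v}
           then - (1 / \<bar>x (fst (G e)) - x (snd (G e))\<bar>) else 0)"
    by (rule sum.cong) (auto simp: mg_boundary_def)
  also have "\<dots> = - (\<Sum>e\<in>mg_boundary G {v. t < x v}. 1 / \<bar>x (fst (G e)) - x (snd (G e))\<bar>)"
    by (simp add: sum.If_cases sum_negf)
  finally show ?thesis .
qed

lemma card_threshold_boundary_squared_le:
  fixes G :: "('v::finite, 'e::finite) multigraph"
  assumes "(\<Sum>e\<in>mg_boundary G {v. t < x v}. \<bar>x (fst (G e)) - x (snd (G e))\<bar>) \<le> 1"
  shows "(real (card (mg_boundary G {v. t < x v})))\<^sup>2
           \<le> (\<Sum>e\<in>mg_boundary G {v. t < x v}. 1 / \<bar>x (fst (G e)) - x (snd (G e))\<bar>)"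
proof -
  let ?S = "mg_boundary G {v. t < x v}" and ?l = "\<lambda>e. \<bar>x (fst (G e)) - x (snd (G e))\<bar>"
  \<comment> \<open>Cauchy--Schwarz is applied to this factorisation of 1. Crossing edges have
    positive length, so no division by 0 occurs.\<close>
  have "real (card ?S) = (\<Sum>e\<in>?S. sqrt (?l e) * sqrt (1 / ?l e))"
  proof -
    have "sqrt (?l e) * sqrt (1 / ?l e) = 1" if "e \<in> ?S" for e
      using that by (auto simp: mg_boundary_def real_sqrt_divide)
    then show ?thesis by simp
  qed
  then have "(real (card ?S))\<^sup>2 \<le> (\<Sum>e\<in>?S. (sqrt (?l e))\<^sup>2) * (\<Sum>e\<in>?S. (sqrt (1 / ?l e))\<^sup>2)"
    by (simp only: Cauchy_Schwarz_ineq_sum)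
  also have "\<dots> = (\<Sum>e\<in>?S. ?l e) * (\<Sum>e\<in>?S. 1 / ?l e)" by simp
  also have "\<dots> \<le> 1 * (\<Sum>e\<in>?S. 1 / ?l e)"
    using assms by (intro mult_right_mono sum_nonneg) auto
  finally show ?thesis by simp
qed

section \<open>Integration over the thresholds above the median\<close>

text \<open>The function \<open>\<Phi> * F - h W\<close> of the threshold has nonnegative
  derivative, because \<open>h'\<close> dominates \<open>1 / max 1 W\<close>. Keeping
  \<open>h\<close> general serves two cases: \<open>ln\<close> while the mass is at least 1, and the
  identity beyond that.\<close>

lemma length_above_diff_le:
  fixes G :: "('v::finite, 'e::finite) multigraph" and h h' :: "real \<Rightarrow> real"
  assumes "\<Phi> > 0" and "s \<le> u"
    and cut: "\<And>t. (\<Sum>e\<in>mg_boundary G {v. t < x v}. \<bar>x (fst (G e)) - x (snd (G e))\<bar>) \<le> 1"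
    and exp: "\<And>t. s \<le> t \<Longrightarrow>
        \<Phi> * real (mg_vol G {v. t < x v}) \<le> real (card (mg_boundary G {v. t < x v}))"
    and h: "\<And>t. \<lbrakk>s \<le> t; t \<le> u\<rbrakk> \<Longrightarrow> (h has_real_derivative h' (mass_above G x t)) (at (mass_above G x t))"
    and h': "\<And>t. \<lbrakk>s \<le> t; t \<le> u\<rbrakk> \<Longrightarrow> 1 \<le> h' (mass_above G x t) * max 1 (mass_above G x t)"
  shows "\<Phi> * (length_above G x s - length_above G x u)
           \<le> h (mass_above G x s) - h (mass_above G x u)"
proof -
  let ?W = "mass_above G x" and ?F = "length_above G x"
  define c where "c = (\<lambda>t. real (card (mg_boundary G {v. t < x v})))"
  define r where "r = (\<lambda>t. \<Sum>e\<in>mg_boundary G {v. t < x v}. 1 / \<bar>x (fst (G e)) - x (snd (G e))\<bar>)"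
  define f' where "f' = (\<lambda>t. \<Phi> * - c t - h' (?W t) * - r t)"
  have "((\<lambda>t. \<Phi> * ?F t - h (?W t)) has_vector_derivative f' t) (at t)"
    if "t \<in> {s..u} - range x" for t
  proof -
    have "((\<lambda>t. \<Phi> * ?F t - h (?W t)) has_real_derivative f' t) (at t)"
      unfolding f'_def using that
      by (intro DERIV_diff DERIV_cmult DERIV_chain2[of h] h)
         (auto simp: c_def r_def intro: DERIV_length_above DERIV_mass_above)
    then show ?thesis by (simp add: has_real_derivative_iff_has_vector_derivative)
  qed
  moreover have "continuous_on {s..u} (\<lambda>t. h (?W t))"
  proof (rule continuous_on_compose2[OF _ continuous_on_mass_above])
    show "continuous_on (?W ` {s..u}) h"
      by (intro continuous_at_imp_continuous_on) (auto intro: DERIV_isCont[OF h])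
  qed simp
  \<comment> \<open>Differentiability may fail at the finitely many vertex potentials; continuity
    suffices there.\<close>
  ultimately have int: "(f' has_integral (\<Phi> * ?F u - h (?W u) - (\<Phi> * ?F s - h (?W s)))) {s..u}"
    using \<open>s \<le> u\<close>
    by (intro fundamental_theorem_of_calculus_strong[where S = "range x"])
       (auto intro!: continuous_intros)
  have "0 \<le> f' t" if t: "t \<in> {s..u}" for t
  proof -
    have W: "?W t \<le> real (mg_vol G {v. t < x v})" by (rule mass_above_le_mg_vol)
    have k: "1 \<le> h' (?W t) * max 1 (?W t)" using h' t by simp
    then have hp: "0 < h' (?W t)"
      by (smt (verit) mult_nonpos_nonneg)
    have c2: "(c t)\<^sup>2 \<le> r t"
      unfolding c_def r_def using cut by (rule card_threshold_boundary_squared_le)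
    have "\<Phi> * c t \<le> h' (?W t) * (c t)\<^sup>2"
    proof (cases "c t = 0")
      case False
      \<comment> \<open>A nonempty cut has at least one edge. Hence the volume above
        \<open>t\<close> is at least 1 and dominates \<open>max 1 W\<close>.\<close>
      then have "1 \<le> c t" by (simp add: c_def Suc_le_eq card_gt_0_iff)
      also have "\<dots> \<le> real (mg_vol G {v. t < x v})"
        by (simp add: c_def card_mg_boundary_le_mg_vol)
      finally have "1 \<le> real (mg_vol G {v. t < x v})" .
      with W have "max 1 (?W t) \<le> real (mg_vol G {v. t < x v})" by simp
      then have "\<Phi> * max 1 (?W t) \<le> \<Phi> * real (mg_vol G {v. t < x v})"
        using \<open>\<Phi> > 0\<close> by simp
      also have "\<dots> \<le> c t" using exp t by (simp add: c_def)
      finally have *: "\<Phi> * max 1 (?W t) \<le> c t" .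
      have "\<Phi> \<le> \<Phi> * (h' (?W t) * max 1 (?W t))" using k \<open>\<Phi> > 0\<close> by simp
      also have "\<dots> = h' (?W t) * (\<Phi> * max 1 (?W t))" by simp
      also have "\<dots> \<le> h' (?W t) * c t" using * hp by simp
      finally have "\<Phi> * c t \<le> h' (?W t) * c t * c t"
        by (intro mult_right_mono) (simp_all add: c_def)
      then show ?thesis by (simp add: power2_eq_square mult.assoc)
    qed simp
    also have "\<dots> \<le> h' (?W t) * r t" using c2 hp by simp
    finally show ?thesis by (simp add: f'_def)
  qed
  from has_integral_nonneg[OF int this] show ?thesis by (simp add: algebra_simps)
qed

text \<open>Split at the threshold where the mass equals 1. The part beyond it contributes at most
  1, the part before it at most the logarithm of the mass above \<open>s\<close>, which is at most
  the number of edges.\<close>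

lemma length_above_le:
  fixes G :: "('v::finite, 'e::finite) multigraph"
  assumes "\<Phi> > 0"
    and expander: "mg_expander \<Phi> G"
    and vol: "mg_vol G {v. s < x v} \<le> CARD('e)"
    and cut: "\<And>t. (\<Sum>e\<in>mg_boundary G {v. t < x v}. \<bar>x (fst (G e)) - x (snd (G e))\<bar>) \<le> 1"
  shows "\<Phi> * length_above G x s \<le> 1 + ln (real CARD('e))"
proof -
  let ?W = "mass_above G x" and ?F = "length_above G x"
  define u where "u = max s (Max (range x))"
  have "x v \<le> u" for v by (simp add: u_def le_max_iff_disj)
  note u0 = above_all_potentials_eq_0[where G = G and x = x, OF this]
  have su: "s \<le> u" by (simp add: u_def)
  have exp: "\<Phi> * real (mg_vol G {v. t < x v}) \<le> real (card (mg_boundary G {v. t < x v}))"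
    if "s \<le> t" for t
  proof -
    have "mg_vol G {v. t < x v} \<le> mg_vol G {v. s < x v}"
      using that by (intro mg_vol_mono) auto
    with vol have "real (mg_vol G {v. t < x v}) \<le> real (mg_vol G UNIV) / 2"
      by (simp add: mg_vol_UNIV)
    with expander show ?thesis by (simp add: mg_expander_def)
  qed
  \<comment> \<open>Both length and mass vanish at \<open>u\<close>, which lies above all
    potentials.\<close>
  have id: "\<Phi> * ?F t \<le> ?W t" if "s \<le> t" "t \<le> u" for t
    using length_above_diff_le[where h = "\<lambda>w. w" and h' = "\<lambda>_. 1" and s = t and u = u,
        OF \<open>\<Phi> > 0\<close> _ cut exp] that u0 by simp
  have m: "1 \<le> CARD('e)" by (simp add: Suc_le_eq)
  show ?thesis
  proof (cases "?W s \<le> 1")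
    case True
    then have "\<Phi> * ?F s \<le> 1" using id[of s] su by simp
    also have "\<dots> \<le> 1 + ln (real CARD('e))" using m by (simp add: ln_ge_zero)
    finally show ?thesis .
  next
    case False
    obtain t where t: "s \<le> t" "t \<le> u" "?W t = 1"
      using IVT2'[of ?W u 1 s] False u0 su continuous_on_mass_above by auto
    have W: "1 \<le> ?W r" if "r \<le> t" for r
      using mass_above_antimono[OF that, of G x] t(3) by simp
    have "\<Phi> * (?F s - ?F t) \<le> ln (?W s) - ln (?W t)"
      using t(1) W exp
      by (intro length_above_diff_le[where h' = inverse, OF \<open>\<Phi> > 0\<close> _ cut])
         (force intro!: DERIV_ln simp: max_absorb2)+
    moreover have "\<Phi> * ?F t \<le> 1" using id[OF t(1,2)] t(3) by simp
    moreover have "ln (?W s) \<le> ln (real CARD('e))"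
      using False mass_above_le_mg_vol[of G x s] vol by (intro ln_mono) auto
    ultimately show ?thesis using t(3) by (simp add: algebra_simps)
  qed
qed

text \<open>Negating the potential turns the part of an edge below \<open>t\<close> into the part
  above \<open>- t\<close>.\<close>

lemma length_above_add_length_below:
  "length_above G x t + length_above G (\<lambda>v. - x v) (- t)
     = (\<Sum>e\<in>UNIV. \<bar>x (fst (G e)) - x (snd (G e))\<bar>)"
  unfolding length_above_def sum.distrib[symmetric]
  by (rule sum.cong) (auto simp: max_def abs_if)

text \<open>At a median threshold neither side has more than half of the volume, so the one-sided
  bound applies to \<open>x\<close> and to its negation.\<close>

lemma total_length_le:
  fixes G :: "('v::finite, 'e::finite) multigraph"
  assumes "\<Phi> > 0" and "mg_expander \<Phi> G"
    and "\<And>t. (\<Sum>e\<in>mg_boundary G {v. t < x v}. \<bar>x (fst (G e)) - x (snd (G e))\<bar>) \<le> 1"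
    and "\<And>t. (\<Sum>e\<in>mg_boundary G {v. x v < t}. \<bar>x (fst (G e)) - x (snd (G e))\<bar>) \<le> 1"
  shows "(\<Sum>e\<in>UNIV. \<bar>x (fst (G e)) - x (snd (G e))\<bar>) \<le> 3 * (ln (2 * real CARD('e)) / \<Phi>)"
proof -
  obtain t where t: "mg_vol G {v. t < x v} \<le> CARD('e)" "mg_vol G {v. x v < t} \<le> CARD('e)"
    by (rule median_threshold)
  have "\<Phi> * length_above G x t \<le> 1 + ln (real CARD('e))"
    using assms t by (intro length_above_le) auto
  moreover have "\<Phi> * length_above G (\<lambda>v. - x v) (- t) \<le> 1 + ln (real CARD('e))"
  proof (rule length_above_le)
    fix s
    show "(\<Sum>e\<in>mg_boundary G {v. s < - x v}. \<bar>- x (fst (G e)) - - x (snd (G e))\<bar>) \<le> 1"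
      using assms(4)[of "- s"] by (simp add: less_minus_iff abs_minus_commute)
  qed (use assms t in simp_all)
  ultimately have "\<Phi> * (\<Sum>e\<in>UNIV. \<bar>x (fst (G e)) - x (snd (G e))\<bar>) \<le> 2 + 2 * ln (real CARD('e))"
    by (simp add: distrib_left flip: length_above_add_length_below[of G x t])
  also have "\<dots> \<le> 3 * (ln 2 + ln (real CARD('e)))"
  proof -
    have "0 \<le> ln (real CARD('e))" by (simp add: ln_ge_zero Suc_le_eq)
    then show ?thesis using ln2_ge_two_thirds by argo
  qed
  also have "\<dots> = 3 * ln (2 * real CARD('e))" by (simp add: ln_mult)
  finally show ?thesis using \<open>\<Phi> > 0\<close> by (simp add: field_simps)
qed

section \<open>The electrical routing\<close>

lemma matrix_diff_ldistrib: "A ** (B - C) = A ** B - A ** (C :: real^'n^'m)"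
  by (simp add: matrix_matrix_mult_def vec_eq_iff right_diff_distrib sum_subtractf)

lemma matrix_diff_rdistrib: "(A - B) ** C = A ** C - B ** (C :: real^'n^'m)"
  by (simp add: matrix_matrix_mult_def vec_eq_iff left_diff_distrib sum_subtractf)

lemma matrix_add_rdistrib: "(A + B) ** C = A ** C + B ** (C :: real^'n^'m)"
  by (simp add: matrix_matrix_mult_def vec_eq_iff distrib_right sum.distrib)

section \<open>Uniqueness and transposition of the pseudo-inverse\<close>

text \<open>Transposing \<open>M Y M X = M X\<close> swaps the symmetric factors \<open>M X\<close>
  and \<open>M Y\<close>, which yields \<open>M X = M Y\<close>; likewise \<open>X M = Y M\<close>.
  Then \<open>X = X M X = X M Y = Y M Y = Y\<close>.\<close>

lemma is_pseudo_inverse_unique: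
  assumes "is_pseudo_inverse M X" and "is_pseudo_inverse M Y"
  shows "X = Y"
proof -
  have X: "M ** X ** M = M" "X ** M ** X = X" "transpose (M ** X) = M ** X" "transpose (X ** M) = X ** M"
    and Y: "M ** Y ** M = M" "Y ** M ** Y = Y" "transpose (M ** Y) = M ** Y" "transpose (Y ** M) = Y ** M"
    using assms by (simp_all add: is_pseudo_inverse_def)
  have "M ** X = transpose ((M ** Y) ** (M ** X))"
    using X Y by (simp add: matrix_mul_assoc)
  also have "\<dots> = (M ** X) ** (M ** Y)"
    using X Y by (simp only: matrix_transpose_mul)
  also have "\<dots> = M ** Y" using X by (simp add: matrix_mul_assoc)
  finally have MX: "M ** X = M ** Y" .
  have "X ** M = transpose ((X ** M) ** (Y ** M))"
  proof -
    have "(X ** M) ** (Y ** M) = X ** (M ** Y ** M)" by (simp add: matrix_mul_assoc)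
    then show ?thesis using X Y by simp
  qed
  also have "\<dots> = (Y ** M) ** (X ** M)"
    using X Y by (simp only: matrix_transpose_mul)
  also have "\<dots> = Y ** (M ** X ** M)" by (simp add: matrix_mul_assoc)
  also have "\<dots> = Y ** M" using X by simp
  finally have XM: "X ** M = Y ** M" .
  have "X = X ** (M ** X)" using X by (simp add: matrix_mul_assoc)
  also have "\<dots> = (X ** M) ** Y" using MX by (simp add: matrix_mul_assoc)
  also have "\<dots> = Y" using XM Y by simp
  finally show ?thesis .
qed

lemma pseudo_inverse_eqI: "is_pseudo_inverse M X \<Longrightarrow> pseudo_inverse M = X"
  unfolding pseudo_inverse_def by (blast intro: the_equality is_pseudo_inverse_unique)

lemma is_pseudo_inverse_transpose:
  assumes "is_pseudo_inverse M X"
  shows "is_pseudo_inverse (transpose M) (transpose X)"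
proof -
  have X: "M ** X ** M = M" "X ** M ** X = X" "transpose (M ** X) = M ** X" "transpose (X ** M) = X ** M"
    using assms by (simp_all add: is_pseudo_inverse_def)
  have "transpose M ** transpose X ** transpose M = transpose (M ** X ** M)"
    and "transpose X ** transpose M ** transpose X = transpose (X ** M ** X)"
    by (simp_all only: matrix_transpose_mul matrix_mul_assoc)
  then show ?thesis
    unfolding is_pseudo_inverse_def using X by (simp flip: matrix_transpose_mul)
qed

section \<open>The Laplacian of a connected graph\<close>

lemma transpose_laplacian: "transpose (laplacian G) = laplacian G"
  by (simp add: laplacian_def matrix_transpose_mul)

lemma potential_difference:
  fixes G :: "('v::finite, 'e::finite) multigraph" and x :: "real^'v"
  shows "(transpose (incidence G) *v x) $ e = x $ snd (G e) - x $ fst (G e)"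
proof -
  have "(transpose (incidence G) *v x) $ e
     = (\<Sum>v\<in>UNIV. (if snd (G e) = v then x $ v else 0) - (if fst (G e) = v then x $ v else 0))"
    unfolding matrix_vector_mult_def transpose_def incidence_def vec_lambda_beta
    by (rule sum.cong) (auto simp: left_diff_distrib)
  then show ?thesis by (simp add: sum_subtractf)
qed

lemma sum_incidence:
  fixes G :: "('v::finite, 'e::finite) multigraph"
  shows "(\<Sum>v\<in>S. incidence G $ v $ e) = of_bool (snd (G e) \<in> S) - of_bool (fst (G e) \<in> S)"
  by (simp add: incidence_def sum_subtractf)

text \<open>The potential difference vanishes across every edge, hence along every path.\<close>

lemma mg_connected_constant:
  fixes G :: "('v::finite, 'e::finite) multigraph" and x :: "real^'v"
  assumes "mg_connected G" and "transpose (incidence G) *v x = 0"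
  shows "x $ u = x $ v"
proof -
  have "(mg_adjacent G)\<^sup>*\<^sup>* u v" using assms(1) by (simp add: mg_connected_def)
  then show ?thesis
  proof induction
    case (step v w)
    from step(2) obtain e where e: "G e = (v, w) \<or> G e = (w, v)" by (auto simp: mg_adjacent_def)
    have "x $ snd (G e) - x $ fst (G e) = 0"
      using potential_difference[of G x e] assms(2) by simp
    with e step show ?case by auto
  qed simp
qed

text \<open>The orthogonal projection onto the constant vectors: it replaces every entry by the
  mean.\<close>

definition mean_projection :: "real^'v^'v" where
  "mean_projection = (\<chi> u v. 1 / real CARD('v))"

lemma mean_projection_nth: "(mean_projection *v x) $ u = (\<Sum>v\<in>UNIV. x $ v) / real CARD('v)"
  for x :: "real^'v::finite"
  by (simp add: mean_projection_def matrix_vector_mult_def sum_divide_distrib)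

lemma transpose_mean_projection: "transpose mean_projection = mean_projection"
  by (simp add: mean_projection_def transpose_def)

lemma mean_projection_idem: "mean_projection ** mean_projection = (mean_projection :: real^'v::finite^'v)"
  by (simp add: mean_projection_def matrix_matrix_mult_def vec_eq_iff)

lemma mean_projection_incidence:
  fixes G :: "('v::finite, 'e::finite) multigraph"
  shows "mean_projection ** incidence G = 0"
  by (simp add: vec_eq_iff mean_projection_def matrix_matrix_mult_def sum_incidence
      flip: sum_divide_distrib)

lemma inner_transpose_matrix: "(transpose A *v x) \<bullet> y = x \<bullet> (A *v y)"
  for A :: "real^'n^'m"
  by (simp add: dot_lmul_matrix)

text \<open>
  On a connected graph the pseudo-inverse is \<open>(L + P)\<^sup>-\<^sup>1 - P\<close>, where \<open>P\<close> is the orthogonal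
  projection onto the constants, that is, onto the kernel of \<open>L\<close>.
\<close>

lemma laplacian_pseudo_inverse:
  fixes G :: "('v::finite, 'e::finite) multigraph"
  assumes "mg_connected G"
  shows "is_pseudo_inverse (laplacian G) (pseudo_inverse (laplacian G))"
    and "laplacian G ** pseudo_inverse (laplacian G) = mat 1 - mean_projection"
proof -
  define B where "B = incidence G"
  define L where "L = laplacian G"
  define P :: "real^'v^'v" where "P = mean_projection"
  define M where "M = L + P"
  have LB: "L = B ** transpose B" by (simp add: L_def B_def laplacian_def)
  have PP: "P ** P = P" and PT: "transpose P = P" and LT: "transpose L = L"
    by (simp_all add: P_def L_def mean_projection_idem transpose_mean_projection transpose_laplacian)
  have PL: "P ** L = 0"
    by (simp add: LB P_def B_def matrix_mul_assoc mean_projection_incidence)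
  have "L ** P = transpose (P ** L)" by (simp only: matrix_transpose_mul PT LT)
  then have LP: "L ** P = 0" by (simp add: PL transpose_def vec_eq_iff)
  \<comment> \<open>\<open>M\<close> is injective because its quadratic form is the sum of the
    squared norms of \<open>transpose B *v x\<close> and \<open>P *v x\<close>.\<close>
  have "x = 0" if "M *v x = 0" for x
  proof -
    have "0 = x \<bullet> (M *v x)" using that by simp
    also have "\<dots> = x \<bullet> (B *v (transpose B *v x)) + x \<bullet> (P *v (P *v x))"
      by (simp only: M_def LB matrix_vector_mult_add_rdistrib inner_add_right matrix_vector_mul_assoc PP)
    also have "\<dots> = (transpose B *v x) \<bullet> (transpose B *v x) + (transpose P *v x) \<bullet> (P *v x)"
      by (simp only: inner_transpose_matrix)
    finally have "(transpose B *v x) \<bullet> (transpose B *v x) + (P *v x) \<bullet> (P *v x) = 0"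
      by (simp only: PT)
    then have "(transpose B *v x) \<bullet> (transpose B *v x) = 0" "(P *v x) \<bullet> (P *v x) = 0"
      using inner_ge_zero[of "transpose B *v x"] inner_ge_zero[of "P *v x"] by linarith+
    then have Bx: "transpose B *v x = 0" and Px: "P *v x = 0"
      by (simp_all only: inner_eq_zero_iff)
    \<comment> \<open>The first vanishing term makes \<open>x\<close> constant, the second makes its
      mean 0.\<close>
    have "x $ u = 0" for u
    proof -
      have "x $ v = x $ u" for v using mg_connected_constant assms Bx by (simp only: B_def)
      then have "(\<Sum>v\<in>UNIV. x $ v) = (\<Sum>v\<in>(UNIV :: 'v set). x $ u)" by (intro sum.cong) auto
      then have "(P *v x) $ u = x $ u" by (simp add: P_def mean_projection_nth)
      with Px show ?thesis by simp
    qed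
    then show "x = 0" by (simp add: vec_eq_iff)
  qed
  then obtain N where NM: "N ** M = mat 1"
    using matrix_left_invertible_ker[of M] by blast
  then have MN: "M ** N = mat 1" by (simp add: matrix_left_right_inverse)
  have MP: "M ** P = P" and PM: "P ** M = P"
    by (simp_all add: M_def matrix_add_ldistrib matrix_add_rdistrib LP PL PP)
  have "N ** P = N ** (M ** P)" by (simp add: MP)
  then have NP: "N ** P = P" by (simp add: matrix_mul_assoc NM)
  have "P ** N = (P ** M) ** N" by (simp add: PM)
  also have "\<dots> = P ** (M ** N)" by (simp add: matrix_mul_assoc)
  finally have PN: "P ** N = P" by (simp add: MN)
  define X where "X = N - P"
  have L: "L = M - P" by (simp add: M_def)
  have LX: "L ** X = mat 1 - P" and XL: "X ** L = mat 1 - P"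
    by (simp_all add: L X_def matrix_diff_ldistrib matrix_diff_rdistrib MN NM MP PM NP PN PP)
  have PX: "P ** X = 0" by (simp add: X_def matrix_diff_ldistrib PN PP)
  have T: "transpose (mat 1 - P) = mat 1 - P"
    using PT by (simp add: transpose_def vec_eq_iff mat_def)
  have "is_pseudo_inverse L X"
    unfolding is_pseudo_inverse_def LX XL T
    by (simp add: matrix_diff_rdistrib PL PX)
  with LX pseudo_inverse_eqI[OF this]
  show "is_pseudo_inverse (laplacian G) (pseudo_inverse (laplacian G))"
    "laplacian G ** pseudo_inverse (laplacian G) = mat 1 - mean_projection"
    by (simp_all add: L_def P_def)
qed

text \<open>Incidence matrix times routing is \<open>L\<close> times its pseudo-inverse, that is,
  the identity minus the mean projection, and a demand has mean 0.\<close>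

lemma electrical_routing_routes:
  fixes G :: "('v::finite, 'e::finite) multigraph"
  assumes "mg_connected G" and "is_demand d"
  shows "routes G (electrical_routing G *v d) d"
proof -
  have "incidence G *v (electrical_routing G *v d)
      = (laplacian G ** pseudo_inverse (laplacian G)) *v d"
    by (simp only: matrix_vector_mul_assoc electrical_routing_def laplacian_def matrix_mul_assoc)
  also have "\<dots> = d - mean_projection *v d"
    by (simp add: laplacian_pseudo_inverse[OF assms(1)] matrix_vector_mult_diff_rdistrib)
  also have "mean_projection *v d = 0"
    using assms(2) by (simp add: vec_eq_iff mean_projection_nth is_demand_def)
  finally show ?thesis by (simp add: routes_def)
qed

text \<open>By uniqueness, the pseudo-inverse of the symmetric Laplacian is symmetric. Row sums and
  column sums of the projection therefore agree.\<close>

lemma symmetric_electrical_projection: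
  fixes G :: "('v::finite, 'e::finite) multigraph"
  assumes "mg_connected G"
  shows "transpose (electrical_routing G ** incidence G) = electrical_routing G ** incidence G"
proof -
  have "transpose (pseudo_inverse (laplacian G)) = pseudo_inverse (laplacian G)"
    using is_pseudo_inverse_transpose[OF laplacian_pseudo_inverse(1)[OF assms]]
    by (metis pseudo_inverse_eqI transpose_laplacian)
  then show ?thesis
    by (simp add: electrical_routing_def matrix_transpose_mul matrix_mul_assoc)
qed

section \<open>Flow across cuts and column sums\<close>

text \<open>Edges with both ends on one side cancel. On each crossing edge the potential flow runs
  into the upper side, so the absolute values add up without cancellation.\<close>

lemma flow_across_threshold:
  fixes G :: "('v::finite, 'e::finite) multigraph" and x :: "real^'v"
  shows "(\<Sum>e\<in>mg_boundary G {v. t < x $ v}. \<bar>x $ fst (G e) - x $ snd (G e)\<bar>)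
           = (\<Sum>v | t < x $ v. (laplacian G *v x) $ v)"
proof -
  let ?S = "{v. t < x $ v}" and ?B = "incidence G"
  have "(\<Sum>v\<in>?S. (laplacian G *v x) $ v)
      = (\<Sum>v\<in>?S. \<Sum>e\<in>UNIV. ?B $ v $ e * (transpose ?B *v x) $ e)"
    by (simp only: laplacian_def flip: matrix_vector_mul_assoc)
       (simp add: matrix_vector_mult_def[of ?B])
  also have "\<dots> = (\<Sum>e\<in>UNIV. (\<Sum>v\<in>?S. ?B $ v $ e) * (x $ snd (G e) - x $ fst (G e)))"
    unfolding potential_difference sum_distrib_right by (rule sum.swap)
  also have "\<dots> = (\<Sum>e\<in>UNIV. if e \<in> mg_boundary G ?S then \<bar>x $ fst (G e) - x $ snd (G e)\<bar> else 0)"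
    unfolding sum_incidence by (rule sum.cong) (auto simp: mg_boundary_def)
  finally show ?thesis by (simp add: sum.If_cases)
qed

lemma electrical_projection_column:
  fixes G :: "('v::finite, 'e::finite) multigraph"
  assumes "mg_connected G" and "\<Phi> > 0" and "mg_expander \<Phi> G"
  shows "(\<Sum>e\<in>UNIV. \<bar>(electrical_routing G ** incidence G) $ e $ e'\<bar>)
           \<le> 3 * (ln (2 * real CARD('e)) / \<Phi>)"
proof -
  define b where "b = column e' (incidence G)"
  define x where "x = pseudo_inverse (laplacian G) *v b"
  have bv: "b $ v = incidence G $ v $ e'" for v by (simp add: b_def column_def)
  have bS: "\<bar>\<Sum>v\<in>S. b $ v\<bar> \<le> 1" for S
    unfolding bv sum_incidence by (auto simp: of_bool_def)
  \<comment> \<open>A column of the incidence matrix has mean 0, so \<open>x\<close> solves the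
    Laplacian equation for \<open>b\<close> exactly.\<close>
  have "mean_projection *v b = 0"
    by (simp add: vec_eq_iff mean_projection_nth bv sum_incidence)
  then have Lx: "laplacian G *v x = b"
    by (simp add: x_def matrix_vector_mul_assoc laplacian_pseudo_inverse[OF assms(1)]
        matrix_vector_mult_diff_rdistrib)
  have R: "(electrical_routing G ** incidence G) $ e $ e' = x $ snd (G e) - x $ fst (G e)" for e
  proof -
    have "(electrical_routing G ** incidence G) $ e $ e' = (electrical_routing G *v b) $ e"
      by (simp add: matrix_matrix_mult_def matrix_vector_mult_def bv)
    also have "electrical_routing G *v b = transpose (incidence G) *v x"
      by (simp only: electrical_routing_def x_def matrix_vector_mul_assoc)
    finally show ?thesis by (simp only: potential_difference)
  qed
  have "(\<Sum>e\<in>UNIV. \<bar>x $ fst (G e) - x $ snd (G e)\<bar>) \<le> 3 * (ln (2 * real CARD('e)) / \<Phi>)"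
  proof (rule total_length_le[OF assms(2,3)])
    fix t
    show "(\<Sum>e\<in>mg_boundary G {v. t < x $ v}. \<bar>x $ fst (G e) - x $ snd (G e)\<bar>) \<le> 1"
      unfolding flow_across_threshold Lx using bS[of "{v. t < x $ v}"] by linarith
    \<comment> \<open>The lower cut of \<open>x\<close> at \<open>t\<close> is the upper cut of
      \<open>- x\<close> at \<open>- t\<close>.\<close>
    have "laplacian G *v (- x) = - b"
      using Lx by (metis matrix_vector_mult_diff_distrib diff_0 matrix_vector_mult_0_right)
    then show "(\<Sum>e\<in>mg_boundary G {v. x $ v < t}. \<bar>x $ fst (G e) - x $ snd (G e)\<bar>) \<le> 1"
      using flow_across_threshold[where G = G and t = "- t" and x = "- x"] bS[of "{v. x $ v < t}"]
      by (simp add: sum_negf abs_minus_commute)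
  qed
  then show ?thesis by (simp add: R abs_minus_commute)
qed

section \<open>Competitive ratios\<close>

lemma lp_norm_1: "lp_norm 1 x = (\<Sum>e\<in>UNIV. \<bar>x $ e\<bar>)"
  by (simp add: lp_norm_def sum_nonneg)

lemma abs_vec_nth: "\<bar>x\<bar> $ i = \<bar>x $ i\<bar>" for x :: "real^'n"
  by (simp add: abs_vec_def)

lemma sum_mset_vec_nth: "(\<Sum>a\<in>#M. f a) $ i = (\<Sum>a\<in>#M. f a $ i)"
  for f :: "'a \<Rightarrow> real^'n"
  by (induction M) auto

lemma sum_mset_abs_nonneg: "0 \<le> (\<Sum>a\<in>#M. \<bar>f a\<bar>)" for f :: "'a \<Rightarrow> real"
  by (induction M) auto

lemma sum_mset_abs_matrix_le:
  fixes R :: "real^'e::finite^'e"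
  shows "(\<Sum>f\<in>#F. \<bar>R *v f\<bar>) $ e \<le> (\<Sum>e'\<in>UNIV. \<bar>R $ e $ e'\<bar> * (\<Sum>f\<in>#F. \<bar>f\<bar>) $ e')"
proof (induction F)
  case (add f F)
  have "\<bar>(R *v f) $ e\<bar> \<le> (\<Sum>e'\<in>UNIV. \<bar>R $ e $ e'\<bar> * \<bar>f $ e'\<bar>)"
    unfolding matrix_vector_mult_def by (simp flip: abs_mult)
  with add show ?case
    by (simp add: abs_vec_nth distrib_left sum.distrib)
qed simp

text \<open>Column sums bound the action on the \<ell>_1-norm and row sums the action on the maximum
  norm; symmetry makes one bound \<open>K\<close> serve both. By the triangle inequality it is
  enough to act with the entrywise absolute value of \<open>R\<close> on the total load
  \<open>g\<close>.\<close>

lemma congestion_matrix_le: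
  fixes R :: "real^'e::finite^'e"
  assumes K: "\<And>e'. (\<Sum>e\<in>UNIV. \<bar>R $ e $ e'\<bar>) \<le> K" and sym: "transpose R = R"
    and p: "p = 1 \<or> p = \<infinity>"
  shows "congestion p (image_mset (\<lambda>f. R *v f) F) \<le> K * congestion p F"
proof -
  define g where "g = (\<Sum>f\<in>#F. \<bar>f\<bar>)"
  define k where "k = (\<Sum>f\<in>#F. \<bar>R *v f\<bar>)"
  have k: "congestion p (image_mset (\<lambda>f. R *v f) F) = lp_norm p k"
    by (simp add: congestion_def k_def image_mset.compositionality comp_def)
  have g0: "0 \<le> g $ e" and k0: "0 \<le> k $ e" for e
    by (simp_all add: g_def k_def sum_mset_vec_nth abs_vec_nth sum_mset_abs_nonneg)
  have kg: "k $ e \<le> (\<Sum>e'\<in>UNIV. \<bar>R $ e $ e'\<bar> * g $ e')" for e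
    unfolding g_def k_def by (rule sum_mset_abs_matrix_le)
  have row: "(\<Sum>e'\<in>UNIV. \<bar>R $ e $ e'\<bar>) \<le> K" for e
  proof -
    have "R $ e $ e' = R $ e' $ e" for e'
      using arg_cong[OF sym, of "\<lambda>A. A $ e' $ e"] by (simp add: transpose_def)
    with K[of e] show ?thesis by simp
  qed
  have "lp_norm p k \<le> K * lp_norm p g"
    using p
  proof
    assume "p = 1"
    have "(\<Sum>e\<in>UNIV. k $ e) \<le> (\<Sum>e\<in>UNIV. \<Sum>e'\<in>UNIV. \<bar>R $ e $ e'\<bar> * g $ e')"
      by (intro sum_mono kg)
    also have "\<dots> = (\<Sum>e'\<in>UNIV. (\<Sum>e\<in>UNIV. \<bar>R $ e $ e'\<bar>) * g $ e')"
      unfolding sum_distrib_right by (rule sum.swap)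
    also have "\<dots> \<le> (\<Sum>e'\<in>UNIV. K * g $ e')"
      by (intro sum_mono mult_right_mono K g0)
    finally show ?thesis
      using g0 k0 \<open>p = 1\<close> by (simp add: lp_norm_1 sum_distrib_left)
  next
    assume p: "p = \<infinity>"
    let ?m = "Max (range (\<lambda>e. \<bar>g $ e\<bar>))"
    have m: "g $ e \<le> ?m" for e
      by (rule order_trans[OF abs_ge_self]) (rule Max_ge, auto)
    have m0: "0 \<le> ?m" by (rule order_trans[OF g0 m])
    have "\<bar>k $ e\<bar> \<le> K * ?m" for e
    proof -
      have "\<bar>k $ e\<bar> \<le> (\<Sum>e'\<in>UNIV. \<bar>R $ e $ e'\<bar> * g $ e')" using kg k0 by simp
      also have "\<dots> \<le> (\<Sum>e'\<in>UNIV. \<bar>R $ e $ e'\<bar> * ?m)"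
        by (intro sum_mono mult_left_mono m) simp
      also have "\<dots> \<le> K * ?m"
        unfolding sum_distrib_right[symmetric] by (intro mult_right_mono row m0)
      finally show ?thesis .
    qed
    then show ?thesis using p by (simp add: lp_norm_def)
  qed
  then show ?thesis unfolding k by (simp add: g_def congestion_def)
qed

text \<open>\<open>routes G\<close> is the graph of a function, so the flows determine the
  demands.\<close>

lemma rel_mset_routes_iff: "rel_mset (routes G) F D \<longleftrightarrow> D = image_mset (\<lambda>f. incidence G *v f) F"
proof -
  have "routes G = (\<lambda>f d. incidence G *v f = d)" by (intro ext) (simp add: routes_def)
  then show ?thesis
    using multiset.rel_map(1)[of "(=)" "\<lambda>f. incidence G *v f" F D] by (auto simp: multiset.rel_eq)
qed

text \<open>If \<open>F\<close> is any routing of \<open>D\<close>, the electrical flows of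
  \<open>D\<close> are the images of the flows in \<open>F\<close> under the projection. Its
  congestion bound thus compares the electrical routing with every competitor, hence with the
  infimum.\<close>

lemma competitive_ratio_electrical_le:
  fixes G :: "('v::finite, 'e::finite) multigraph"
  assumes "mg_connected G" and "K > 0" and p: "p = 1 \<or> p = \<infinity>"
    and K: "\<And>e'. (\<Sum>e\<in>UNIV. \<bar>(electrical_routing G ** incidence G) $ e $ e'\<bar>) \<le> K"
  shows "competitive_ratio G p (electrical_routing G) \<le> ereal K"
  unfolding competitive_ratio_def
proof (rule SUP_least, clarify)
  fix D :: "(real^'v) multiset"
  assume D: "\<forall>d\<in>#D. is_demand d" and pos: "0 < opt_congestion G p D"
  let ?A = "electrical_routing G"
  let ?c = "congestion p (image_mset (\<lambda>d. ?A *v d) D)"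
  have "?c / K \<le> opt_congestion G p D"
    unfolding opt_congestion_def
  proof (rule cInf_greatest)
    \<comment> \<open>The electrical flows themselves show that the infimum is over a nonempty
      set.\<close>
    have "rel_mset (routes G) (image_mset (\<lambda>d. ?A *v d) D) D"
    proof -
      have "image_mset (\<lambda>d. incidence G *v (?A *v d)) D = image_mset (\<lambda>d. d) D"
        using D electrical_routing_routes[OF assms(1)]
        by (intro image_mset_cong) (auto simp: routes_def)
      then show ?thesis
        by (simp add: rel_mset_routes_iff image_mset.compositionality comp_def)
    qed
    then show "{congestion p F |F. rel_mset (routes G) F D} \<noteq> {}" by blast
  next
    fix c assume "c \<in> {congestion p F |F. rel_mset (routes G) F D}"
    then obtain F where F: "c = congestion p F" "D = image_mset (\<lambda>f. incidence G *v f) F"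
      by (auto simp: rel_mset_routes_iff)
    have "?c = congestion p (image_mset (\<lambda>f. (?A ** incidence G) *v f) F)"
      by (simp add: F(2) image_mset.compositionality comp_def matrix_vector_mul_assoc)
    also have "\<dots> \<le> K * c"
      unfolding F(1) using symmetric_electrical_projection[OF assms(1)] p K
      by (intro congestion_matrix_le) auto
    finally show "?c / K \<le> c" using \<open>K > 0\<close> by (simp add: field_simps)
  qed
  then show "ereal (?c / opt_congestion G p D) \<le> ereal K"
    using pos \<open>K > 0\<close> by (simp add: field_simps)
qed

theorem theorem1p1:
  fixes G :: "('v::finite, 'e::finite) multigraph" and \<Phi> :: real
  assumes "mg_connected G"
    and "\<Phi> > 0"
    and "mg_expander \<Phi> G"
  shows "competitive_ratio G \<infinity> (electrical_routing G)
           \<le> ereal (3 * (ln (2 * real CARD('e)) / \<Phi>))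
       \<and> competitive_ratio G 1 (electrical_routing G)
           \<le> ereal (3 * (ln (2 * real CARD('e)) / \<Phi>))"
proof -
  have "0 < 3 * (ln (2 * real CARD('e)) / \<Phi>)"
  proof -
    have "1 \<le> real CARD('e)" by (simp add: Suc_le_eq)
    then have "0 < ln (2 * real CARD('e))" by (intro ln_gt_zero) linarith
    with assms(2) show ?thesis by simp
  qed
  then show ?thesis
    using competitive_ratio_electrical_le[OF assms(1)] electrical_projection_column[OF assms] by blast
qed

end
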